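(* Let $2 \le m \le n$ and let $G$ and $H$ be connected graphs of orders $m$ and $n$, respectively. For every integer $k \ge 1$, $$d_k(G \boxtimes H) \ge \min\{\, n + 2\delta(G) - 1,\ m + 2\delta(H) - 1 \,\}.$$
   Context: $\delta(\cdot)$ is the minimum degree. $G \boxtimes H$ is the strong product: vertex set $V(G)\times V(H)$, with distinct $(x,y)$ and $(u,v)$ adjacent iff ($x=u$ or $xu\in E(G)$) and ($y=v$ or $yv\in E(H)$). The $k$-move deduction game ($k$ a positive integer) on a finite graph $G$: a layout places a finite number of searchers on vertices of $G$ (several searchers may share a vertex). Every searcher is initially mobile. A vertex is protected once it has been occupied by some searcher (so initially occupied vertices are protected); other vertices are unprotected. The game proceeds in stages. At each stage, for every vertex $v$ that has at least one unprotected neighbour: if the number of mobile searchers on $v$ is at least the number of unprotected neighbours of $v$, then the mobile searchers on $v$ move to the unprotected neighbours of $v$ so that each unprotected neighbour receives at least one searcher; excess mobile searchers on $v$ may also move to any of these unprotected neighbours. All moves in a stage happen simultaneously, newly occupied vertices become protected, and a searcher that has moved $k$ times becomes immobile. The process repeats until all vertices are protected or no searcher can move. A layout is successful if all vertices of $G$ end up protected. The $k$-move deduction number $d_k(G)$ is the minimum number of searchers in a successful layout on $G$. *)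

theory Defs
  imports "Graph_Theory.Graph_Theory"
begin

text \<open>
  A finite simple graph is a \<^locale>\<open>pair_graph\<close>: a finite loop-free symmetric digraph without
  parallel arcs, in which an edge \<open>uv\<close> is represented by the two arcs \<open>(u, v)\<close> and \<open>(v, u)\<close>.
\<close>

definition neighbours :: "'a pair_pre_digraph \<Rightarrow> 'a \<Rightarrow> 'a set" where
  "neighbours G v = {u. (v, u) \<in> parcs G}"

definition min_degree :: "'a pair_pre_digraph \<Rightarrow> nat" where
  "min_degree G = Min ((\<lambda>v. card (neighbours G v)) ` pverts G)"

definition strong_product ::
    "'a pair_pre_digraph \<Rightarrow> 'b pair_pre_digraph \<Rightarrow> ('a \<times> 'b) pair_pre_digraph"
    (infixl "\<boxtimes>" 70) where
  "G \<boxtimes> H = \<lparr> pverts = pverts G \<times> pverts H,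
             parcs = {((x, y), (u, v)) | x y u v.
               (x, y) \<in> pverts G \<times> pverts H \<and> (u, v) \<in> pverts G \<times> pverts H \<and>
               (x, y) \<noteq> (u, v) \<and>
               (x = u \<or> (x, u) \<in> parcs G) \<and> (y = v \<or> (y, v) \<in> parcs H)} \<rparr>"

lemma pair_graph_strong_product:
  assumes "pair_graph G" "pair_graph H"
  shows "pair_graph (G \<boxtimes> H)"
proof -
  interpret G: pair_graph G by fact
  interpret H: pair_graph H by fact
  have "parcs (G \<boxtimes> H) \<subseteq> (pverts G \<times> pverts H) \<times> (pverts G \<times> pverts H)"
    by (auto simp: strong_product_def)
  then have "finite (parcs (G \<boxtimes> H))"
    using G.pair_finite_verts H.pair_finite_verts by (meson finite_SigmaI finite_subset)
  then show ?thesis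
    using G.pair_finite_verts H.pair_finite_verts G.arcs_symmetric H.arcs_symmetric
    by unfold_locales (auto simp: strong_product_def symmetric_def intro!: symI)
qed


text \<open>
  The searchers of a layout with \<open>s\<close> searchers are numbered \<open>0, \<dots>, s - 1\<close>. A state of the game
  consists of the position of every searcher, the number of moves every searcher has made so far,
  and the set of protected vertices; values at numbers \<open>\<ge> s\<close> are irrelevant.
\<close>

record 'a game_state =
  pos :: "nat \<Rightarrow> 'a"
  moves :: "nat \<Rightarrow> nat"
  prot :: "'a set"

definition unprotected_neighbours :: "'a pair_pre_digraph \<Rightarrow> 'a game_state \<Rightarrow> 'a \<Rightarrow> 'a set" where
  "unprotected_neighbours G S v = neighbours G v - prot S"

definition mobile_on :: "nat \<Rightarrow> nat \<Rightarrow> 'a game_state \<Rightarrow> 'a \<Rightarrow> nat set" where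
  "mobile_on k s S v = {i. i < s \<and> pos S i = v \<and> moves S i < k}"

definition fires :: "'a pair_pre_digraph \<Rightarrow> nat \<Rightarrow> nat \<Rightarrow> 'a game_state \<Rightarrow> 'a \<Rightarrow> bool" where
  "fires G k s S v \<longleftrightarrow> v \<in> pverts G \<and> unprotected_neighbours G S v \<noteq> {} \<and>
     card (unprotected_neighbours G S v) \<le> card (mobile_on k s S v)"

text \<open>
  A stage is a relation rather than a function: it is left open which searcher of a firing vertex
  goes to which unprotected neighbour, and which of the excess searchers move.
\<close>

definition stage ::
    "'a pair_pre_digraph \<Rightarrow> nat \<Rightarrow> nat \<Rightarrow> 'a game_state \<Rightarrow> 'a game_state \<Rightarrow> bool" where
  "stage G k s S T \<longleftrightarrow>
     (\<forall>i<s. (pos T i = pos S i \<and> moves T i = moves S i) \<or>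
            (fires G k s S (pos S i) \<and> moves S i < k \<and>
             pos T i \<in> unprotected_neighbours G S (pos S i) \<and> moves T i = Suc (moves S i))) \<and>
     (\<forall>v. fires G k s S v \<longrightarrow>
        (\<forall>u \<in> unprotected_neighbours G S v. \<exists>i \<in> mobile_on k s S v. pos T i = u)) \<and>
     prot T = prot S \<union> pos T ` {..<s}"

definition initial_state :: "nat \<Rightarrow> (nat \<Rightarrow> 'a) \<Rightarrow> 'a game_state" where
  "initial_state s l = \<lparr> pos = l, moves = (\<lambda>_. 0), prot = l ` {..<s} \<rparr>"

text \<open>
  When no vertex fires, a stage changes nothing, so reachability of a state in which all vertices are
  protected does not depend on stopping the game explicitly.
\<close>

definition successful :: "'a pair_pre_digraph \<Rightarrow> nat \<Rightarrow> nat \<Rightarrow> (nat \<Rightarrow> 'a) \<Rightarrow> bool" where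
  "successful G k s l \<longleftrightarrow> l ` {..<s} \<subseteq> pverts G \<and>
     (\<exists>T. (stage G k s)\<^sup>*\<^sup>* (initial_state s l) T \<and> pverts G \<subseteq> prot T)"

definition deduction_number :: "nat \<Rightarrow> 'a pair_pre_digraph \<Rightarrow> nat" where
  "deduction_number k G = (LEAST s. \<exists>l. successful G k s l)"

text \<open>Placing one searcher on every vertex is successful, so the minimum is attained.\<close>

lemma deduction_number_attained:
  assumes "finite (pverts G)"
  shows "\<exists>l. successful G k (deduction_number k G) l"
proof -
  obtain l where "bij_betw l {..<card (pverts G)} (pverts G)"
    using ex_bij_betw_nat_finite[OF assms] by (auto simp: atLeast0LessThan)
  then have "l ` {..<card (pverts G)} = pverts G"
    by (simp add: bij_betw_def)
  then have "successful G k (card (pverts G)) l"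
    unfolding successful_def
    by (auto simp: initial_state_def intro!: exI[of _ "initial_state (card (pverts G)) l"])
  then have "\<exists>l. successful G k (card (pverts G)) l" by blast
  then show ?thesis
    unfolding deduction_number_def by (rule LeastI)
qed

end

theory Submission
  imports Defs
begin

text \<open>
  A vertex that is protected but has not fired still holds a searcher, and a firing vertex holds at
  least as many searchers as it has unprotected neighbours. Call \<open>V(G) \<times> {y}\<close> a row and
  \<open>{x} \<times> V(H)\<close> a column, and consider the first stage after which the fired vertices meet all
  but at most one row, or all but at most one column; say rows. Before this stage some column
  contains no fired vertex, so by connectedness of \<open>G\<close> every row with a fired vertex also has
  a protected unfired one. Hence at this stage every row, except possibly one row \<open>y0\<close> without
  fired vertices, holds a searcher. Moreover \<open>y0\<close> and a second row \<open>y'\<close> that is met only now together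
  hold \<open>2 \<delta>(G) + 1\<close> searchers: if a neighbour row of \<open>y0\<close> is met only now, take it for \<open>y'\<close> and count
  around its firing vertex; otherwise an earlier firing next to \<open>y0\<close> has left \<open>\<delta>(G) + 1\<close> searchers
  stuck on \<open>y0\<close>, and the firing vertex of \<open>y'\<close> gives \<open>\<delta>(G)\<close> more. If no such stage exists, then in the
  end two rows and two columns consist of unfired protected vertices, which are sufficiently many.
\<close>

section \<open>Closed neighbourhoods, minimum degree and connectedness\<close>

definition closed_neighbours :: "'a pair_pre_digraph \<Rightarrow> 'a \<Rightarrow> 'a set" where
  "closed_neighbours G v = insert v (neighbours G v)"

lemma closed_neighbours_self: "v \<in> closed_neighbours G v"
  by (simp add: closed_neighbours_def)

context pair_graph
begin

lemma neighbours_subset: "neighbours G v \<subseteq> pverts G"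
  by (auto simp: neighbours_def dest: in_arcsD2)

lemma neighbours_sym: "u \<in> neighbours G v \<Longrightarrow> v \<in> neighbours G u"
  unfolding neighbours_def mem_Collect_eq by (rule arcs_symmetric)

lemma not_in_neighbours: "v \<notin> neighbours G v"
  using pair_no_loops[of "(v, v)"] by (auto simp: neighbours_def)

lemma closed_neighbours_subset: "v \<in> pverts G \<Longrightarrow> closed_neighbours G v \<subseteq> pverts G"
  using neighbours_subset by (auto simp: closed_neighbours_def)

lemma finite_neighbours: "finite (neighbours G v)"
  using neighbours_subset pair_finite_verts by (rule finite_subset)

lemma finite_closed_neighbours: "finite (closed_neighbours G v)"
  using finite_neighbours by (simp add: closed_neighbours_def)

lemma card_closed_neighbours: "card (closed_neighbours G v) = Suc (card (neighbours G v))"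
  using finite_neighbours not_in_neighbours by (simp add: closed_neighbours_def)

lemma min_degree_less_card_closed_neighbours:
  assumes "v \<in> pverts G"
  shows "Suc (min_degree G) \<le> card (closed_neighbours G v)"
  using assms pair_finite_verts by (simp add: card_closed_neighbours min_degree_def)

lemma min_degree_less_card_verts:
  assumes "pverts G \<noteq> {}"
  shows "Suc (min_degree G) \<le> card (pverts G)"
proof -
  obtain v where v: "v \<in> pverts G" using assms by blast
  have "card (closed_neighbours G v) \<le> card (pverts G)"
    using closed_neighbours_subset[OF v] pair_finite_verts by (rule card_mono[rotated])
  then show ?thesis
    using min_degree_less_card_closed_neighbours[OF v] by simp
qed

text \<open>A path from \<open>u\<close> to \<open>v\<close> must leave \<open>A\<close> somewhere.
  Symmetry of the arcs turns connectedness into strong connectedness, so a directed path exists to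
  follow.\<close>

lemma connected_boundary:
  assumes "Digraph_Component.connected (with_proj G)" "u \<in> A" "u \<in> pverts G" "v \<notin> A" "v \<in> pverts G"
  obtains x y where "x \<in> A" "y \<notin> A" "x \<in> pverts G" "y \<in> neighbours G x"
proof -
  have sc: "strongly_connected (with_proj G)"
    using symmetric_connected_imp_strongly_connected pair_sym_arcs assms(1) by blast
  then have reach: "u \<rightarrow>\<^sup>*\<^bsub>with_proj G\<^esub> v"
    using assms(3,5) by (auto simp: strongly_connected_def)
  have "v \<in> A \<or> (\<exists>x y. x \<in> A \<and> y \<notin> A \<and> x \<in> pverts G \<and> y \<in> neighbours G x)"
    using reach
  proof (induction rule: reachable_induct)
    case base
    then show ?case using assms(2) by blast
  next
    case (step x y)
    then show ?case by (auto simp: neighbours_def dest: in_arcsD1)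
  qed
  then show thesis using assms(4) that by blast
qed

lemma connected_has_neighbour:
  assumes "Digraph_Component.connected (with_proj G)" "v \<in> pverts G" "2 \<le> card (pverts G)"
  obtains u where "u \<in> neighbours G v"
proof -
  obtain w where "w \<in> pverts G" "w \<noteq> v"
    using assms(2,3) card_mono[of "{v}" "pverts G"] by force
  with connected_boundary[OF assms(1), of v "{v}" w] assms(2) that show thesis by blast
qed

end

text \<open>The product form lets degree counts factor into cardinalities of closed neighbourhoods
  in \<open>G\<close> and \<open>H\<close>.\<close>

lemma neighbours_strong_product:
  assumes "x \<in> pverts G" "y \<in> pverts H" "pair_graph G" "pair_graph H"
  shows "neighbours (G \<boxtimes> H) (x, y) = closed_neighbours G x \<times> closed_neighbours H y - {(x, y)}"
proof -
  interpret G: pair_graph G by fact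
  interpret H: pair_graph H by fact
  show ?thesis
    using assms(1,2)
    by (auto simp: neighbours_def strong_product_def closed_neighbours_def
        dest: G.in_arcsD2 H.in_arcsD2)
qed

section \<open>Counting searchers at a single stage\<close>

text \<open>
  One stage of the game on \<open>G \<boxtimes> H\<close>: \<open>c\<close> counts searchers, and \<open>P\<close>, \<open>R\<close>, \<open>F\<close> single out the vertices
  that are protected, have fired earlier, and fire now. The relations are curried so that exchanging
  \<open>G\<close> and \<open>H\<close> only swaps arguments.
\<close>

locale product_stage =
  fixes G :: "'a pair_pre_digraph" and H :: "'b pair_pre_digraph"
    and c :: "'a \<Rightarrow> 'b \<Rightarrow> nat" and P R F :: "'a \<Rightarrow> 'b \<Rightarrow> bool"
  assumes graph_G: "pair_graph G" and graph_H: "pair_graph H"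
    and conn_G: "Digraph_Component.connected (with_proj G)"
    and conn_H: "Digraph_Component.connected (with_proj H)"
    and order_G: "2 \<le> card (pverts G)" and order_H: "2 \<le> card (pverts H)"
    and R_verts: "R x y \<Longrightarrow> x \<in> pverts G \<and> y \<in> pverts H"
    and R_protects: "R x y \<Longrightarrow> x' \<in> closed_neighbours G x \<Longrightarrow> y' \<in> closed_neighbours H y \<Longrightarrow> P x' y'"
    and occupied: "P x y \<Longrightarrow> \<not> R x y \<Longrightarrow> x \<in> pverts G \<Longrightarrow> y \<in> pverts H \<Longrightarrow> 1 \<le> c x y"
    and F_verts: "F x y \<Longrightarrow> x \<in> pverts G \<and> y \<in> pverts H"
    and F_occupied: "F x y \<Longrightarrow> 1 \<le> c x y"
    and F_count: "F x y \<Longrightarrow>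
      card {p \<in> closed_neighbours G x \<times> closed_neighbours H y. \<not> P (fst p) (snd p)} \<le> c x y"
begin

sublocale G: pair_graph G by (rule graph_G)
sublocale H: pair_graph H by (rule graph_H)

text \<open>This transfers every statement about rows to columns. Only \<open>F_count\<close> takes
  work, because its set of pairs has to be reversed.\<close>

lemma swap: "product_stage H G (\<lambda>y x. c x y) (\<lambda>y x. P x y) (\<lambda>y x. R x y) (\<lambda>y x. F x y)"
proof
  fix y x
  assume F: "F x y"
  have "bij_betw prod.swap
      {p \<in> closed_neighbours H y \<times> closed_neighbours G x. \<not> P (snd p) (fst p)}
      {p \<in> closed_neighbours G x \<times> closed_neighbours H y. \<not> P (fst p) (snd p)}"
    by (rule bij_betw_byWitness[where f' = prod.swap]) auto
  then show "card {p \<in> closed_neighbours H y \<times> closed_neighbours G x. \<not> P (snd p) (fst p)} \<le> c x y"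
    using F_count[OF F] by (simp add: bij_betw_same_card)
qed (use graph_G graph_H conn_G conn_H order_G order_H R_verts R_protects occupied F_verts F_occupied
  in auto)

lemma occupied_card:
  assumes "finite Q" "Q \<subseteq> pverts G \<times> pverts H" "\<And>x y. (x, y) \<in> Q \<Longrightarrow> P x y \<and> \<not> R x y"
  shows "card Q \<le> (\<Sum>(x, y)\<in>Q. c x y)"
proof -
  have "(\<Sum>p\<in>Q. 1) \<le> (\<Sum>(x, y)\<in>Q. c x y)"
  proof (intro sum_mono)
    fix p assume "p \<in> Q"
    then show "1 \<le> (case p of (x, y) \<Rightarrow> c x y)"
      using assms(2) assms(3)[of "fst p" "snd p"] occupied[of "fst p" "snd p"] by (cases p) auto
  qed
  then show ?thesis by simp
qed

text \<open>The searchers on the firing vertex pay for all unprotected vertices around it, even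
  those outside \<open>Q\<close>; each protected unfired vertex of \<open>Q\<close> pays for itself.
  Only the firing vertex remains unpaid, hence the \<open>Suc\<close>.\<close>

lemma firing_card:
  assumes F: "F x y" and Q: "(x, y) \<in> Q" "finite Q" "Q \<subseteq> pverts G \<times> pverts H"
    and unfired: "\<And>x y. (x, y) \<in> Q \<Longrightarrow> \<not> R x y"
  shows "card (Q \<inter> closed_neighbours G x \<times> closed_neighbours H y) \<le> Suc (\<Sum>(x, y)\<in>Q. c x y)"
proof -
  define B where "B = closed_neighbours G x \<times> closed_neighbours H y"
  define U where "U = {p \<in> B. \<not> P (fst p) (snd p)}"
  \<comment> \<open>Removing \<open>(x, y)\<close> keeps its searchers, already spent on
    \<open>U\<close>, from being counted twice.\<close>
  define D where "D = {p \<in> Q \<inter> B. P (fst p) (snd p)} - {(x, y)}"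
  have fin: "finite B" "finite D" "finite U"
    using G.finite_closed_neighbours H.finite_closed_neighbours Q(2)
    by (auto simp: B_def U_def D_def)
  have "card (Q \<inter> B) \<le> card (insert (x, y) (D \<union> U))"
    using fin by (intro card_mono) (auto simp: D_def U_def)
  also have "\<dots> \<le> Suc (card D + card U)"
    using fin card_Un_le[of D U] by (simp add: card_insert_if)
  also have "card D \<le> (\<Sum>(x, y)\<in>D. c x y)"
    using Q(3) unfired by (intro occupied_card fin) (auto simp: D_def)
  also have "card U \<le> c x y"
    using F_count[OF F] by (simp add: U_def B_def)
  also have "(\<Sum>(x, y)\<in>D. c x y) + c x y = (\<Sum>(x, y)\<in>insert (x, y) D. c x y)"
    using fin by (subst sum.insert) (auto simp: D_def)
  also have "\<dots> \<le> (\<Sum>(x, y)\<in>Q. c x y)"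
    using Q by (intro sum_mono2) (auto simp: D_def)
  finally show ?thesis by (simp add: B_def)
qed

section \<open>Searchers in the rows\<close>

definition row :: "'b \<Rightarrow> nat" where
  "row y = (\<Sum>x\<in>pverts G. c x y)"

lemma sum_rows: "(\<Sum>(x, y)\<in>pverts G \<times> Y. c x y) = (\<Sum>y\<in>Y. row y)"
  unfolding row_def by (subst sum.swap) (simp add: sum.cartesian_product)

text \<open>If the row has a fired vertex, then, since \<open>x0\<close> is unfired there, some
  unfired vertex of the row is adjacent to a fired one; it is protected and hence still
  occupied.\<close>

lemma row_pos:
  assumes "x0 \<in> pverts G" "\<not> R x0 y" "R x y \<or> F x y"
  shows "1 \<le> row y"
proof -
  have "\<exists>z\<in>pverts G. 1 \<le> c z y"
  proof (cases "R x y")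
    case True
    obtain z w where zw: "R z y" "\<not> R w y" "w \<in> neighbours G z" "z \<in> pverts G"
      by (rule G.connected_boundary[OF conn_G, of x "{z. R z y}" x0])
        (use True assms(1,2) R_verts[OF True] in simp_all)
    moreover have "P w y"
      using R_protects[OF zw(1), of w y] zw(3) by (simp add: closed_neighbours_def)
    ultimately show ?thesis
      using occupied[of w y] R_verts[OF zw(1)] G.neighbours_subset by auto
  next
    case False
    then have "F x y" using assms(3) by simp
    then show ?thesis using F_verts F_occupied by blast
  qed
  then obtain z where "z \<in> pverts G" "1 \<le> c z y" by blast
  moreover from this have "c z y \<le> row y"
    unfolding row_def using G.pair_finite_verts by (intro member_le_sum) auto
  ultimately show ?thesis by simp
qed

text \<open>As no vertex of row \<open>y1\<close> has fired earlier, \<open>hit\<close> makes one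
  fire now; \<open>y1\<close> serves as \<open>y'\<close> when every neighbour row of
  \<open>y0\<close> was met earlier.\<close>

lemma two_rows:
  assumes y0: "y0 \<in> pverts H" "\<And>x. \<not> R x y0"
    and y1: "y1 \<in> pverts H" "y1 \<noteq> y0" "\<And>x. \<not> R x y1"
    and hit: "\<And>y. y \<in> pverts H \<Longrightarrow> y \<noteq> y0 \<Longrightarrow> \<exists>x. R x y \<or> F x y"
  obtains y' where "y' \<in> pverts H" "y' \<noteq> y0" "2 * min_degree G + 1 \<le> row y0 + row y'"
proof (cases "\<exists>y'\<in>neighbours H y0. \<forall>x. \<not> R x y'")
  case True
  then obtain y' where y': "y' \<in> neighbours H y0" "\<And>x. \<not> R x y'" by blast
  have V: "y' \<in> pverts H" "y' \<noteq> y0"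
    using y'(1) H.neighbours_subset H.not_in_neighbours by blast+
  obtain x where F: "F x y'" using hit[OF V] y'(2) by blast
  have x: "x \<in> pverts G" using F_verts[OF F] by blast
  let ?Q = "pverts G \<times> {y0, y'}"
  \<comment> \<open>The rows \<open>y0\<close> and \<open>y'\<close> are adjacent, so the firing
    vertex sees a closed neighbourhood in each: \<open>2 * (min_degree G + 1)\<close> vertices,
    minus one lost in \<open>firing_card\<close>.\<close>
  have "closed_neighbours G x \<times> {y0, y'} \<subseteq> ?Q \<inter> closed_neighbours G x \<times> closed_neighbours H y'"
    using G.closed_neighbours_subset[OF x] H.neighbours_sym[OF y'(1)]
    by (auto simp: closed_neighbours_def)
  then have "card (closed_neighbours G x \<times> {y0, y'})
      \<le> card (?Q \<inter> closed_neighbours G x \<times> closed_neighbours H y')"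
    by (rule card_mono[rotated]) (simp add: G.pair_finite_verts)
  also have "\<dots> \<le> Suc (\<Sum>(x, y)\<in>?Q. c x y)"
    using F x y0 y' V G.pair_finite_verts by (intro firing_card) auto
  also have "(\<Sum>(x, y)\<in>?Q. c x y) = row y0 + row y'"
    using V(2) by (simp add: sum_rows)
  finally have "2 * min_degree G + 1 \<le> row y0 + row y'"
    using G.min_degree_less_card_closed_neighbours[OF x] V(2)
    by (simp add: card_cartesian_product)
  with V that show thesis by blast
next
  case False
  obtain z where z: "z \<in> neighbours H y0"
    using H.connected_has_neighbour[OF conn_H y0(1) order_H] by blast
  then obtain b where b: "R b z" using False by blast
  have bG: "b \<in> pverts G" using R_verts[OF b] by blast
  have "card (closed_neighbours G b) = card (closed_neighbours G b \<times> {y0})"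
    by (simp add: card_cartesian_product)
  also have "\<dots> \<le> (\<Sum>(x, y)\<in>closed_neighbours G b \<times> {y0}. c x y)"
  proof (rule occupied_card)
    show "P x y \<and> \<not> R x y" if "(x, y) \<in> closed_neighbours G b \<times> {y0}" for x y
      using that y0(2) R_protects[OF b] H.neighbours_sym[OF z] by (auto simp: closed_neighbours_def)
  qed (use G.finite_closed_neighbours G.closed_neighbours_subset[OF bG] y0(1) in auto)
  also have "\<dots> \<le> (\<Sum>(x, y)\<in>pverts G \<times> {y0}. c x y)"
    using G.closed_neighbours_subset[OF bG] G.pair_finite_verts by (intro sum_mono2) auto
  also have "\<dots> = row y0" by (simp add: sum_rows)
  finally have r0: "Suc (min_degree G) \<le> row y0"
    using G.min_degree_less_card_closed_neighbours[OF bG] by simp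
  obtain x where F: "F x y1" using hit[OF y1(1,2)] y1(3) by blast
  have x: "x \<in> pverts G" using F_verts[OF F] by blast
  let ?Q = "pverts G \<times> {y1}"
  have "card (closed_neighbours G x) = card (closed_neighbours G x \<times> {y1})"
    by (simp add: card_cartesian_product)
  also have "\<dots> \<le> card (?Q \<inter> closed_neighbours G x \<times> closed_neighbours H y1)"
    using G.closed_neighbours_subset[OF x] G.pair_finite_verts
    by (intro card_mono) (auto simp: closed_neighbours_self)
  also have "\<dots> \<le> Suc (\<Sum>(x, y)\<in>?Q. c x y)"
    using F x y1 G.pair_finite_verts by (intro firing_card) auto
  also have "(\<Sum>(x, y)\<in>?Q. c x y) = row y1" by (simp add: sum_rows)
  finally have "min_degree G \<le> row y1"
    using G.min_degree_less_card_closed_neighbours[OF x] by simp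
  with r0 y1(1,2) show thesis by (intro that[of y1]) auto
qed

text \<open>The rows \<open>y0\<close> and \<open>y'\<close> contribute
  \<open>2 * min_degree G + 1\<close> and each of the other \<open>card (pverts H) - 2\<close> rows
  at least one.\<close>

lemma rows_bound:
  assumes y0: "y0 \<in> pverts H" "\<And>x. \<not> R x y0"
    and y1: "y1 \<in> pverts H" "y1 \<noteq> y0" "\<And>x. \<not> R x y1"
    and x0: "x0 \<in> pverts G" "\<And>y. \<not> R x0 y"
    and hit: "\<And>y. y \<in> pverts H \<Longrightarrow> y \<noteq> y0 \<Longrightarrow> \<exists>x. R x y \<or> F x y"
  shows "card (pverts H) + 2 * min_degree G - 1 \<le> (\<Sum>(x, y)\<in>pverts G \<times> pverts H. c x y)"
proof -
  obtain y' where y': "y' \<in> pverts H" "y' \<noteq> y0" "2 * min_degree G + 1 \<le> row y0 + row y'"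
    using two_rows[OF y0 y1 hit] by blast
  have "card (pverts H - {y0, y'}) = card (pverts H) - 2"
    using y0(1) y' H.pair_finite_verts by (subst card_Diff_subset) auto
  moreover have "(\<Sum>y\<in>pverts H - {y0, y'}. 1) \<le> (\<Sum>y\<in>pverts H - {y0, y'}. row y)"
  proof (intro sum_mono)
    fix y assume "y \<in> pverts H - {y0, y'}"
    then obtain x where "R x y \<or> F x y" using hit[of y] by blast
    then show "1 \<le> row y" using row_pos x0 by blast
  qed
  moreover have "(\<Sum>y\<in>pverts H. row y) = row y0 + row y' + (\<Sum>y\<in>pverts H - {y0, y'}. row y)"
    using y0(1) y'(1,2) H.pair_finite_verts sum.subset_diff[of "{y0, y'}" "pverts H" row]
    by simp
  ultimately show ?thesis
    using y'(3) order_H by (simp add: sum_rows)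
qed

section \<open>Bounds from the numbers of rows and columns met\<close>

definition hit_rows :: "'b set" where
  "hit_rows = {y. \<exists>x. R x y}"

definition hit_columns :: "'a set" where
  "hit_columns = {x. \<exists>y. R x y}"

lemma hit_subset: "hit_rows \<subseteq> pverts H" "hit_columns \<subseteq> pverts G"
  using R_verts by (auto simp: hit_rows_def hit_columns_def)

lemma rows_bound_card:
  assumes few_rows: "card hit_rows + 2 \<le> card (pverts H)"
    and few_columns: "card hit_columns < card (pverts G)"
    and many_rows: "card (pverts H) \<le> Suc (card {y. \<exists>x. R x y \<or> F x y})"
  shows "card (pverts H) + 2 * min_degree G - 1 \<le> (\<Sum>(x, y)\<in>pverts G \<times> pverts H. c x y)"
proof -
  let ?Y = "{y. \<exists>x. R x y \<or> F x y}"
  have Y: "?Y \<subseteq> pverts H" using R_verts F_verts by blast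
  then have finY: "finite ?Y" using H.pair_finite_verts finite_subset by blast
  have fin: "finite hit_rows" "finite hit_columns"
    using hit_subset G.pair_finite_verts H.pair_finite_verts finite_subset by blast+
  have "hit_rows \<noteq> pverts H" using few_rows by auto
  \<comment> \<open>If all rows are met by now, any row not met earlier can be \<open>y0\<close>;
    otherwise \<open>many_rows\<close> allows just one missed row.\<close>
  have "\<exists>y0\<in>pverts H - hit_rows. pverts H \<subseteq> insert y0 ?Y"
  proof (cases "pverts H \<subseteq> ?Y")
    case True
    then show ?thesis using \<open>hit_rows \<noteq> pverts H\<close> hit_subset(1) by blast
  next
    case False
    then obtain y0 where y0: "y0 \<in> pverts H" "y0 \<notin> ?Y" by blast
    have "insert y0 ?Y = pverts H"
      using y0 Y finY many_rows H.pair_finite_verts by (intro card_seteq) auto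
    then show ?thesis using y0 by (auto simp: hit_rows_def)
  qed
  then obtain y0 where y0: "y0 \<in> pverts H - hit_rows" "pverts H \<subseteq> insert y0 ?Y" by blast
  have "\<not> pverts H \<subseteq> insert y0 hit_rows"
    using card_mono[of "insert y0 hit_rows" "pverts H"] fin few_rows y0(1) by auto
  then obtain y1 where y1: "y1 \<in> pverts H" "y1 \<noteq> y0" "y1 \<notin> hit_rows" by blast
  have "\<not> pverts G \<subseteq> hit_columns"
    using card_mono[of hit_columns "pverts G"] fin few_columns by auto
  then obtain x0 where x0: "x0 \<in> pverts G" "x0 \<notin> hit_columns" by blast
  show ?thesis
    using y0 y1 x0 by (intro rows_bound[of y0 y1 x0]) (auto simp: hit_rows_def hit_columns_def)
qed

text \<open>Every vertex outside \<open>hit_columns \<times> hit_rows\<close> is protected and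
  unfired, hence occupied. With two free rows and two free columns there are at least
  \<open>2m + 2n - 4\<close> of these, where \<open>m\<close> and \<open>n\<close> are the orders of
  \<open>G\<close> and \<open>H\<close>, while \<open>min_degree G\<close> is at most
  \<open>m - 1\<close>.\<close>

lemma all_protected_bound:
  assumes "\<And>x y. x \<in> pverts G \<Longrightarrow> y \<in> pverts H \<Longrightarrow> P x y"
    and few: "card hit_rows + 2 \<le> card (pverts H)" "card hit_columns + 2 \<le> card (pverts G)"
  shows "card (pverts H) + 2 * min_degree G - 1 \<le> (\<Sum>(x, y)\<in>pverts G \<times> pverts H. c x y)"
proof -
  let ?V = "pverts G \<times> pverts H"
  have fin: "finite hit_rows" "finite hit_columns" "finite ?V"
    using hit_subset G.pair_finite_verts H.pair_finite_verts finite_subset by blast+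
  obtain i j where ij: "card (pverts H) = card hit_rows + 2 + i"
      "card (pverts G) = card hit_columns + 2 + j"
    using few le_Suc_ex by metis
  have "card (pverts H) + 2 * min_degree G - 1 \<le> card (pverts H) + 2 * card (pverts G) - 3"
    using G.min_degree_less_card_verts order_G by fastforce
  also have "\<dots> \<le> (card hit_columns + 2 + j) * (card hit_rows + 2 + i) - card hit_columns * card hit_rows"
    unfolding ij by (simp add: algebra_simps)
  also have "\<dots> = card ?V - card (hit_columns \<times> hit_rows)"
    by (simp add: card_cartesian_product ij)
  also have "\<dots> = card (?V - hit_columns \<times> hit_rows)"
    using fin hit_subset by (intro card_Diff_subset[symmetric]) auto
  also have "\<dots> \<le> (\<Sum>(x, y)\<in>?V - hit_columns \<times> hit_rows. c x y)"
    using assms(1) fin by (intro occupied_card) (auto simp: hit_rows_def hit_columns_def)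
  also have "\<dots> \<le> (\<Sum>(x, y)\<in>?V. c x y)"
    using fin by (intro sum_mono2) auto
  finally show ?thesis .
qed

end

section \<open>Invariants along a play\<close>

locale play = pair_graph G for G :: "'a pair_pre_digraph" +
  fixes k s T :: nat and S :: "nat \<Rightarrow> 'a game_state"
  assumes start: "prot (S 0) = pos (S 0) ` {..<s}"
    and step: "t < T \<Longrightarrow> stage G k s (S t) (S (Suc t))"
begin

text \<open>A \<open>game_state\<close> keeps no record of firings, so they are read off from the
  sequence of states.\<close>

definition fired :: "nat \<Rightarrow> 'a set" where
  "fired t = {v. \<exists>i<t. fires G k s (S i) v}"

text \<open>Immobile searchers count too, which makes the resulting bound the same for every
  \<open>k\<close>.\<close>

definition searchers :: "nat \<Rightarrow> 'a \<Rightarrow> nat" where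
  "searchers t v = card {i. i < s \<and> pos (S t) i = v}"

lemma fired_0: "fired 0 = {}"
  by (simp add: fired_def)

lemma fired_Suc: "fired (Suc t) = fired t \<union> {v. fires G k s (S t) v}"
  by (auto simp: fired_def less_Suc_eq)

lemma fired_verts: "fired t \<subseteq> pverts G"
  by (auto simp: fired_def fires_def)

lemma pos_protected: "t \<le> T \<Longrightarrow> i < s \<Longrightarrow> pos (S t) i \<in> prot (S t)"
  using start step[of "t - 1"] by (cases t) (auto simp: stage_def)

lemma fires_card_le:
  assumes "fires G k s (S t) v"
  shows "card (unprotected_neighbours G (S t) v) \<le> searchers t v"
proof -
  have "card (unprotected_neighbours G (S t) v) \<le> card (mobile_on k s (S t) v)"
    using assms by (simp add: fires_def)
  also have "\<dots> \<le> searchers t v"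
    unfolding searchers_def by (intro card_mono) (auto simp: mobile_on_def)
  finally show ?thesis .
qed

lemma fires_searchers:
  assumes "fires G k s (S t) v"
  shows "1 \<le> searchers t v"
proof -
  have "finite (unprotected_neighbours G (S t) v)" "unprotected_neighbours G (S t) v \<noteq> {}"
    using assms finite_neighbours by (auto simp: fires_def unprotected_neighbours_def)
  then have "1 \<le> card (unprotected_neighbours G (S t) v)"
    by (simp add: Suc_le_eq card_gt_0_iff)
  then show ?thesis
    using fires_card_le[OF assms] by simp
qed

lemma fires_protected:
  assumes "t \<le> T" "fires G k s (S t) v"
  shows "v \<in> prot (S t)"
proof -
  have "{i. i < s \<and> pos (S t) i = v} \<noteq> {}"
    using fires_searchers[OF assms(2)] unfolding searchers_def by (metis card.empty not_one_le_zero)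
  then show ?thesis
    using pos_protected[OF assms(1)] by blast
qed

lemma fired_protects:
  assumes "t \<le> T" "v \<in> fired t"
  shows "closed_neighbours G v \<subseteq> prot (S t)"
  using assms
proof (induction t)
  case 0
  then show ?case by (simp add: fired_0)
next
  case (Suc t)
  have st: "stage G k s (S t) (S (Suc t))" using Suc.prems step by simp
  then have mono: "prot (S t) \<subseteq> prot (S (Suc t))" by (auto simp: stage_def)
  show ?case
  proof (cases "v \<in> fired t")
    case True
    then show ?thesis using Suc mono by simp
  next
    case False
    then have F: "fires G k s (S t) v" using Suc.prems by (simp add: fired_Suc)
    have "unprotected_neighbours G (S t) v \<subseteq> prot (S (Suc t))"
    proof
      fix u assume "u \<in> unprotected_neighbours G (S t) v"
      then obtain i where "i \<in> mobile_on k s (S t) v" "pos (S (Suc t)) i = u"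
        using st F unfolding stage_def by blast
      then show "u \<in> prot (S (Suc t))"
        using pos_protected[OF Suc.prems(1)] by (auto simp: mobile_on_def)
    qed
    then show ?thesis
      using fires_protected[OF _ F] Suc.prems mono
      by (auto simp: closed_neighbours_def unprotected_neighbours_def)
  qed
qed

text \<open>Searchers leave a vertex only when it fires, so one that protected \<open>v\<close> is
  still there.\<close>

lemma unfired_searchers:
  assumes "t \<le> T" "v \<in> prot (S t)" "v \<notin> fired t"
  shows "1 \<le> searchers t v"
proof -
  have "\<exists>i<s. pos (S t) i = v"
    using assms
  proof (induction t)
    case 0
    then show ?case using start by auto
  next
    case (Suc t)
    have st: "stage G k s (S t) (S (Suc t))" using Suc.prems step by simp
    show ?case
    proof (cases "v \<in> prot (S t)")
      case True
      then obtain i where i: "i < s" "pos (S t) i = v"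
        using Suc by (auto simp: fired_Suc)
      moreover have "\<not> fires G k s (S t) v" using Suc.prems by (simp add: fired_Suc)
      ultimately have "pos (S (Suc t)) i = v" using st unfolding stage_def by metis
      with i show ?thesis by blast
    next
      case False
      then show ?thesis using st Suc.prems by (auto simp: stage_def)
    qed
  qed
  then show ?thesis
    unfolding searchers_def by (auto simp: Suc_le_eq card_gt_0_iff)
qed

lemma sum_searchers:
  assumes "finite A"
  shows "(\<Sum>v\<in>A. searchers t v) \<le> s"
proof -
  have "(\<Sum>v\<in>A. searchers t v) = card (\<Union>v\<in>A. {i. i < s \<and> pos (S t) i = v})"
    unfolding searchers_def using assms by (intro card_UN_disjoint[symmetric]) auto
  also have "\<dots> \<le> card {..<s}" by (intro card_mono) auto
  finally show ?thesis by simp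
qed

end

section \<open>The lower bound for successful layouts\<close>

lemma successful_strong_product_bound:
  fixes G :: "'a pair_pre_digraph" and H :: "'b pair_pre_digraph"
  assumes G: "pair_graph G" "Digraph_Component.connected (with_proj G)" "2 \<le> card (pverts G)"
    and H: "pair_graph H" "Digraph_Component.connected (with_proj H)" "2 \<le> card (pverts H)"
    and succ: "successful (G \<boxtimes> H) k s l"
  shows "min (card (pverts H) + 2 * min_degree G - 1) (card (pverts G) + 2 * min_degree H - 1) \<le> s"
proof -
  let ?V = "pverts G \<times> pverts H"
  have V: "pverts (G \<boxtimes> H) = ?V" by (simp add: strong_product_def)
  interpret GH: pair_graph "G \<boxtimes> H" by (rule pair_graph_strong_product[OF G(1) H(1)])
  have finV: "finite ?V" using GH.pair_finite_verts V by simp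
  obtain Z where Z: "(stage (G \<boxtimes> H) k s)\<^sup>*\<^sup>* (initial_state s l) Z" "?V \<subseteq> prot Z"
    using succ V unfolding successful_def by auto
  obtain T where "(stage (G \<boxtimes> H) k s ^^ T) (initial_state s l) Z"
    using rtranclp_imp_relpowp[OF Z(1)] by blast
  then obtain S where S: "S 0 = initial_state s l"
      "\<And>t. t < T \<Longrightarrow> stage (G \<boxtimes> H) k s (S t) (S (Suc t))"
      and final: "?V \<subseteq> prot (S T)"
    using Z(2) unfolding relpowp_fun_conv by blast
  interpret play "G \<boxtimes> H" k s T S
    using S by (intro play.intro play_axioms.intro pair_graph_strong_product G H)
      (auto simp: initial_state_def)
  define F where "F t x y \<longleftrightarrow> fires (G \<boxtimes> H) k s (S t) (x, y)" for t x y
  \<comment> \<open>The locale speaks only of the state before the moves, so the final time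
    \<open>T\<close> is included although no stage follows it.\<close>
  have stage: "product_stage G H (\<lambda>x y. searchers t (x, y)) (\<lambda>x y. (x, y) \<in> prot (S t))
      (\<lambda>x y. (x, y) \<in> fired t) (F t)" if t: "t \<le> T" for t
  proof (intro product_stage.intro G H)
    fix x x' y y'
    show R: "x \<in> pverts G \<and> y \<in> pverts H" if "(x, y) \<in> fired t"
      using fired_verts that V by blast
    show F': "x \<in> pverts G \<and> y \<in> pverts H" if "F t x y"
      using that V by (auto simp: F_def fires_def)
    show "(x', y') \<in> prot (S t)"
      if "(x, y) \<in> fired t" "x' \<in> closed_neighbours G x" "y' \<in> closed_neighbours H y"
      using fired_protects[OF t that(1)] that(2,3) R[OF that(1)] G(1) H(1)
      by (auto simp: closed_neighbours_def[of "G \<boxtimes> H"] neighbours_strong_product)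
    show "1 \<le> searchers t (x, y)" if "(x, y) \<in> prot (S t)" "(x, y) \<notin> fired t"
      using unfired_searchers[OF t that] .
    show "1 \<le> searchers t (x, y)" if "F t x y"
      using fires_searchers that by (simp add: F_def)
    show "card {p \<in> closed_neighbours G x \<times> closed_neighbours H y. (fst p, snd p) \<notin> prot (S t)}
        \<le> searchers t (x, y)" if F: "F t x y"
    proof -
      \<comment> \<open>The left side could also contain the centre \<open>(x, y)\<close>, but a
        firing vertex is protected.\<close>
      have "{p \<in> closed_neighbours G x \<times> closed_neighbours H y. (fst p, snd p) \<notin> prot (S t)}
          = unprotected_neighbours (G \<boxtimes> H) (S t) (x, y)"
        using fires_protected[OF t] F F'[OF F] G(1) H(1)
        by (auto simp: F_def unprotected_neighbours_def neighbours_strong_product)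
      then show ?thesis using fires_card_le F by (simp add: F_def)
    qed
  qed
  define rows where "rows t = {y. \<exists>x. (x, y) \<in> fired t}" for t
  define columns where "columns t = {x. \<exists>y. (x, y) \<in> fired t}" for t
  have rows_Suc: "{y. \<exists>x. (x, y) \<in> fired t \<or> F t x y} = rows (Suc t)"
    and columns_Suc: "{x. \<exists>y. (x, y) \<in> fired t \<or> F t x y} = columns (Suc t)" for t
    by (auto simp: rows_def columns_def F_def fired_Suc)
  have total: "(\<Sum>(x, y)\<in>?V. searchers t (x, y)) \<le> s" for t
    using sum_searchers[OF finV, of t] by (simp add: split_def)
  have total': "(\<Sum>(y, x)\<in>pverts H \<times> pverts G. searchers t (x, y)) \<le> s" for t
  proof -
    have "(\<Sum>(y, x)\<in>pverts H \<times> pverts G. searchers t (x, y))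
        = (\<Sum>(x, y)\<in>?V. searchers t (x, y))"
      unfolding sum.cartesian_product[symmetric] by (rule sum.swap)
    then show ?thesis using total[of t] by simp
  qed
  define few where "few t \<longleftrightarrow> card (rows t) + 2 \<le> card (pverts H) \<and> card (columns t) + 2 \<le> card (pverts G)"
    for t
  have few0: "few 0" using G(3) H(3) by (simp add: few_def rows_def columns_def fired_0)
  show ?thesis
  proof (cases "few T")
    case True
    interpret product_stage G H "\<lambda>x y. searchers T (x, y)" "\<lambda>x y. (x, y) \<in> prot (S T)"
      "\<lambda>x y. (x, y) \<in> fired T" "F T"
      by (rule stage) simp
    have "card (pverts H) + 2 * min_degree G - 1 \<le> (\<Sum>(x, y)\<in>?V. searchers T (x, y))"
    proof (rule all_protected_bound)
      show "card hit_rows + 2 \<le> card (pverts H)" "card hit_columns + 2 \<le> card (pverts G)"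
        using True by (simp_all add: few_def hit_rows_def hit_columns_def rows_def columns_def)
    qed (use final in auto)
    also have "\<dots> \<le> s" by (rule total)
    finally have "card (pverts H) + 2 * min_degree G - 1 \<le> s" .
    then show ?thesis by simp
  next
    case False
    \<comment> \<open>This \<open>t\<close> is the stage at which \<open>few\<close> is lost. Two
      rows and two columns are still free before it, and at most one row or at most one column after
      it.\<close>
    then obtain t where t: "t < T" "few t" "\<not> few (Suc t)"
      using few0 ex_least_nat_less[of "\<lambda>t. \<not> few t" T] by auto
    interpret A: product_stage G H "\<lambda>x y. searchers t (x, y)" "\<lambda>x y. (x, y) \<in> prot (S t)"
      "\<lambda>x y. (x, y) \<in> fired t" "F t"
      using t by (intro stage) simp
    interpret B: product_stage H G "\<lambda>y x. searchers t (x, y)" "\<lambda>y x. (x, y) \<in> prot (S t)"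
      "\<lambda>y x. (x, y) \<in> fired t" "\<lambda>y x. F t x y"
      by (rule A.swap)
    have eqs: "A.hit_rows = rows t" "A.hit_columns = columns t"
        "B.hit_rows = columns t" "B.hit_columns = rows t"
      by (auto simp: A.hit_rows_def B.hit_rows_def A.hit_columns_def B.hit_columns_def
          rows_def columns_def)
    from t(3) consider "card (pverts H) \<le> Suc (card (rows (Suc t)))"
      | "card (pverts G) \<le> Suc (card (columns (Suc t)))"
      unfolding few_def by linarith
    then show ?thesis
    proof cases
      case 1
      then show ?thesis
        using A.rows_bound_card t(2) total[of t] by (simp add: eqs rows_Suc few_def)
    next
      case 2
      then show ?thesis
        using B.rows_bound_card t(2) total'[of t] by (simp add: eqs columns_Suc few_def)
    qed
  qed
qed

theorem theorem5p1:
  fixes G :: "'a pair_pre_digraph" and H :: "'b pair_pre_digraph" and m n k :: nat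
  assumes "2 \<le> m" and "m \<le> n"
    and "pair_graph G" and "Digraph_Component.connected (with_proj G)" and "card (pverts G) = m"
    and "pair_graph H" and "Digraph_Component.connected (with_proj H)" and "card (pverts H) = n"
    and "1 \<le> k"
  shows "deduction_number k (G \<boxtimes> H) \<ge> min (n + 2 * min_degree G - 1) (m + 2 * min_degree H - 1)"
proof -
  interpret pair_graph "G \<boxtimes> H"
    using assms by (intro pair_graph_strong_product)
  obtain l where "successful (G \<boxtimes> H) k (deduction_number k (G \<boxtimes> H)) l"
    using deduction_number_attained pair_finite_verts by blast
  then show ?thesis
    using successful_strong_product_bound[of G H] assms by simp
qed

end
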